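(* Let $x' \in \{0,1\}^{n'}$ be a binary vector indexed by $E$, and let $x$ be the binary vector indexed by the arcs of $k\mathcal{G}$ defined by $x_E = x'$, $x_{E^1} = \mathbf{1}$, $x_{E^0} = \mathbf{0}$. Then $x'$ is feasible for the R-BQP if and only if $x$ is feasible for the BQP. Moreover, their respective objective values coincide, i.e. $x^\top \tilde{Q} x = (x')^\top Q' x' + (c')^\top x' + \kappa$.
   Context: Setting. $\mathcal{G}=(\mathcal{N},\mathcal{E})$ is a finite directed graph without loops (arcs are ordered pairs of distinct vertices), with $k$ source--target pairs $(s_1,t_1),\dots,(s_k,t_k)$ whose $2k$ terminals are pairwise distinct vertices. For $i=1,\dots,k$ let $\mathcal{G}_i=(\mathcal{N}_i,\mathcal{E}_i)$ be a copy of $\mathcal{G}$, with $\mathcal{N}_i=\{v^i: v\in\mathcal{N}\}$ and $\mathcal{E}_i=\{(u^i,v^i):(u,v)\in\mathcal{E}\}$, and let $k\mathcal{G}=\bigsqcup_{i=1}^k\mathcal{G}_i$, with $m=k|\mathcal{N}|$ vertices and $n=k|\mathcal{E}|$ arcs. $\delta_+(w)$ and $\delta_-(w)$ denote the sets of arcs leaving and entering $w$. For $S\subseteq\mathcal{N}_i$, $\mathcal{E}_i(S)$ is the set of arcs of $\mathcal{G}_i$ with both endpoints in $S$. $A\in\mathbb{R}^{m\times n}$ is the vertex--arc incidence matrix of $k\mathcal{G}$ (entry $+1$ at the tail, $-1$ at the head of each arc), and $b\in\mathbb{R}^m$ has $b_{v^i}=1$ if $v=s_i$, $-1$ if $v=t_i$,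 and $0$ otherwise. $\tilde{Q}$ is a real symmetric $n\times n$ matrix. BQP: minimize $x^\top\tilde{Q}x$ over $x\in\{0,1\}^n$ subject to (1) $Ax=b$; (2) $\sum_{i=1}^k\sum_{e\in\delta_+(v^i)}x_e\le 1$ and $\sum_{i=1}^k\sum_{e\in\delta_-(v^i)}x_e\le 1$ for all $v\in\mathcal{N}$ (vertex-disjointness); (3) $\sum_{e\in\mathcal{E}_i(S)}x_e\le|S|-1$ for all $i$ and all $S\subseteq\mathcal{N}_i$ with $|S|\ge2$ (subtour elimination). The BQP is assumed feasible. $E^0$ (resp. $E^1$) is the set of all arcs $e$ of $k\mathcal{G}$ such that $x_e=0$ (resp. $x_e=1$) for every feasible solution $x$ of the BQP. The reduced graph $G=(V,E)$ is obtained from $k\mathcal{G}$ by removing the arcs $E^0\cup E^1$; $n'=|E|$. $A'$ is the incidence matrix of $G$ (the submatrix of $A$ of columns in $E$), and $b'=b-\sum_{e\in E^1}A_e$, where $A_e$ is the column of $A$ for arc $e$. R-BQP: minimize $(x')^\top Q'x'+(c')^\top x'+\kappa$ over $x'\in\{0,1\}^{n'}$ subject to $A'x'=b'$ and the constraints (2) and (3) with all sums restricted to arcs in $E$ (i.e. imposed on the graph $G$). Here $Q'=\tilde{Q}_{EE}$ (the principal submatrix of $\tilde{Q}$ indexed by $E$), $c'_e=\sum_{f\in E^1}(\tilde{Q}_{ef}+\tilde{Q}_{fe})$ for $e\in E$, and $\kappa=\sum_{e\in E^1}\sum_{f\in E^1}\tilde{Q}_{ef}$. *)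

theory Defs
  imports Complex_Main "HOL-Library.FuncSet" "Graph_Theory.Pair_Digraph"
begin

text \<open>
  The copy v^i of a vertex v is the pair (v, i), with layers i = 1, ..., k.  Vectors and matrices
  indexed by finite sets of vertices or arcs are functions on these sets; the vectors of variables
  are extensional (undefined outside the index set), so that they correspond one-to-one to the
  vectors in {0,1}^n.
\<close>

type_synonym 'a cvert = "'a \<times> nat"
type_synonym 'a carc = "'a cvert \<times> 'a cvert"
type_synonym 'a cgraph = "'a cvert pair_pre_digraph"

definition terminal_pairs :: "'a set \<Rightarrow> nat \<Rightarrow> (nat \<Rightarrow> 'a) \<Rightarrow> (nat \<Rightarrow> 'a) \<Rightarrow> bool" where
  "terminal_pairs N k s t \<longleftrightarrow>
     s ` {1..k} \<subseteq> N \<and> t ` {1..k} \<subseteq> N \<and>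
     inj_on s {1..k} \<and> inj_on t {1..k} \<and> s ` {1..k} \<inter> t ` {1..k} = {}"

definition copies :: "nat \<Rightarrow> 'a pair_pre_digraph \<Rightarrow> 'a cgraph" where
  "copies k D = \<lparr> pverts = {(v, i) | v i. v \<in> pverts D \<and> i \<in> {1..k}},
                 parcs = {((u, i), (v, i)) | u v i. (u, v) \<in> parcs D \<and> i \<in> {1..k}} \<rparr>"

definition incidence :: "'a cvert \<Rightarrow> 'a carc \<Rightarrow> real" where
  "incidence w e = (if w = fst e then 1 else if w = snd e then - 1 else 0)"

definition demand :: "(nat \<Rightarrow> 'a) \<Rightarrow> (nat \<Rightarrow> 'a) \<Rightarrow> 'a cvert \<Rightarrow> real" where
  "demand s t w = (let (v, i) = w in if v = s i then 1 else if v = t i then - 1 else 0)"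

definition arcs_within :: "'b pair_pre_digraph \<Rightarrow> 'b set \<Rightarrow> ('b \<times> 'b) set" where
  "arcs_within H S = {e \<in> parcs H. fst e \<in> S \<and> snd e \<in> S}"

definition binary_vectors :: "'b set \<Rightarrow> ('b \<Rightarrow> real) set" where
  "binary_vectors F = F \<rightarrow>\<^sub>E {0, 1}"

definition flow_constraint ::
  "'a cgraph \<Rightarrow> ('a cvert \<Rightarrow> real) \<Rightarrow> ('a carc \<Rightarrow> real) \<Rightarrow> bool" where
  "flow_constraint H d x \<longleftrightarrow> (\<forall>w\<in>pverts H. (\<Sum>e\<in>parcs H. incidence w e * x e) = d w)"

definition disjointness_constraint ::
  "'a set \<Rightarrow> nat \<Rightarrow> 'a cgraph \<Rightarrow> ('a carc \<Rightarrow> real) \<Rightarrow> bool" where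
  "disjointness_constraint N k H x \<longleftrightarrow>
     (\<forall>v\<in>N. (\<Sum>i=1..k. \<Sum>e\<in>out_arcs (with_proj H) (v, i). x e) \<le> 1 \<and>
            (\<Sum>i=1..k. \<Sum>e\<in>in_arcs (with_proj H) (v, i). x e) \<le> 1)"

definition subtour_constraint ::
  "'a set \<Rightarrow> nat \<Rightarrow> 'a cgraph \<Rightarrow> ('a carc \<Rightarrow> real) \<Rightarrow> bool" where
  "subtour_constraint N k H x \<longleftrightarrow>
     (\<forall>i\<in>{1..k}. \<forall>S. S \<subseteq> N \<times> {i} \<and> card S \<ge> 2 \<longrightarrow>
        (\<Sum>e\<in>arcs_within H S. x e) \<le> real (card S) - 1)"

text \<open>
  The common constraint system of BQP and R-BQP, imposed on a graph H with vertex set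
  N \<times> {1..k} and right-hand side d of the flow constraint.
\<close>

definition feasible_on ::
  "'a set \<Rightarrow> nat \<Rightarrow> 'a cgraph \<Rightarrow> ('a cvert \<Rightarrow> real) \<Rightarrow> ('a carc \<Rightarrow> real) \<Rightarrow> bool" where
  "feasible_on N k H d x \<longleftrightarrow>
     x \<in> binary_vectors (parcs H) \<and> flow_constraint H d x \<and>
     disjointness_constraint N k H x \<and> subtour_constraint N k H x"

definition bqp_feasible ::
  "'a pair_pre_digraph \<Rightarrow> nat \<Rightarrow> (nat \<Rightarrow> 'a) \<Rightarrow> (nat \<Rightarrow> 'a) \<Rightarrow> ('a carc \<Rightarrow> real) \<Rightarrow> bool" where
  "bqp_feasible D k s t x \<longleftrightarrow> feasible_on (pverts D) k (copies k D) (demand s t) x"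

definition arcs0 ::
  "'a pair_pre_digraph \<Rightarrow> nat \<Rightarrow> (nat \<Rightarrow> 'a) \<Rightarrow> (nat \<Rightarrow> 'a) \<Rightarrow> 'a carc set" where
  "arcs0 D k s t = {e \<in> parcs (copies k D). \<forall>x. bqp_feasible D k s t x \<longrightarrow> x e = 0}"

definition arcs1 ::
  "'a pair_pre_digraph \<Rightarrow> nat \<Rightarrow> (nat \<Rightarrow> 'a) \<Rightarrow> (nat \<Rightarrow> 'a) \<Rightarrow> 'a carc set" where
  "arcs1 D k s t = {e \<in> parcs (copies k D). \<forall>x. bqp_feasible D k s t x \<longrightarrow> x e = 1}"

definition reduced_graph ::
  "'a pair_pre_digraph \<Rightarrow> nat \<Rightarrow> (nat \<Rightarrow> 'a) \<Rightarrow> (nat \<Rightarrow> 'a) \<Rightarrow> 'a cgraph" where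
  "reduced_graph D k s t =
     \<lparr> pverts = pverts (copies k D),
       parcs = parcs (copies k D) - (arcs0 D k s t \<union> arcs1 D k s t) \<rparr>"

definition reduced_demand ::
  "'a pair_pre_digraph \<Rightarrow> nat \<Rightarrow> (nat \<Rightarrow> 'a) \<Rightarrow> (nat \<Rightarrow> 'a) \<Rightarrow> 'a cvert \<Rightarrow> real" where
  "reduced_demand D k s t w = demand s t w - (\<Sum>e\<in>arcs1 D k s t. incidence w e)"

definition rbqp_feasible ::
  "'a pair_pre_digraph \<Rightarrow> nat \<Rightarrow> (nat \<Rightarrow> 'a) \<Rightarrow> (nat \<Rightarrow> 'a) \<Rightarrow> ('a carc \<Rightarrow> real) \<Rightarrow> bool" where
  "rbqp_feasible D k s t x' \<longleftrightarrow>
     feasible_on (pverts D) k (reduced_graph D k s t) (reduced_demand D k s t) x'"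

text \<open>
  The quadratic form of the principal submatrix of Q indexed by F.
\<close>

definition quad_form :: "'b set \<Rightarrow> ('b \<Rightarrow> 'b \<Rightarrow> real) \<Rightarrow> ('b \<Rightarrow> real) \<Rightarrow> real" where
  "quad_form F Q x = (\<Sum>e\<in>F. \<Sum>f\<in>F. x e * Q e f * x f)"

definition bqp_objective ::
  "'a pair_pre_digraph \<Rightarrow> nat \<Rightarrow> ('a carc \<Rightarrow> 'a carc \<Rightarrow> real) \<Rightarrow> ('a carc \<Rightarrow> real) \<Rightarrow> real" where
  "bqp_objective D k Q x = quad_form (parcs (copies k D)) Q x"

definition reduced_linear ::
  "'a pair_pre_digraph \<Rightarrow> nat \<Rightarrow> (nat \<Rightarrow> 'a) \<Rightarrow> (nat \<Rightarrow> 'a) \<Rightarrow>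
   ('a carc \<Rightarrow> 'a carc \<Rightarrow> real) \<Rightarrow> 'a carc \<Rightarrow> real" where
  "reduced_linear D k s t Q e = (\<Sum>f\<in>arcs1 D k s t. Q e f + Q f e)"

definition reduced_constant ::
  "'a pair_pre_digraph \<Rightarrow> nat \<Rightarrow> (nat \<Rightarrow> 'a) \<Rightarrow> (nat \<Rightarrow> 'a) \<Rightarrow>
   ('a carc \<Rightarrow> 'a carc \<Rightarrow> real) \<Rightarrow> real" where
  "reduced_constant D k s t Q = (\<Sum>e\<in>arcs1 D k s t. \<Sum>f\<in>arcs1 D k s t. Q e f)"

definition rbqp_objective ::
  "'a pair_pre_digraph \<Rightarrow> nat \<Rightarrow> (nat \<Rightarrow> 'a) \<Rightarrow> (nat \<Rightarrow> 'a) \<Rightarrow>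
   ('a carc \<Rightarrow> 'a carc \<Rightarrow> real) \<Rightarrow> ('a carc \<Rightarrow> real) \<Rightarrow> real" where
  "rbqp_objective D k s t Q x' =
     quad_form (parcs (reduced_graph D k s t)) Q x'
     + (\<Sum>e\<in>parcs (reduced_graph D k s t). reduced_linear D k s t Q e * x' e)
     + reduced_constant D k s t Q"

text \<open>
  If the BQP is feasible, then the arcs of the reduced graph, the arcs fixed to 1 and the arcs fixed
  to 0 partition the arcs of the k copies, so that the three cases below do not overlap.
\<close>

lemma fixed_arcs_disjoint:
  assumes "\<exists>x. bqp_feasible D k s t x"
  shows "arcs0 D k s t \<inter> arcs1 D k s t = {}"
  using assms by (fastforce simp: arcs0_def arcs1_def)

definition extend_solution ::
  "'a pair_pre_digraph \<Rightarrow> nat \<Rightarrow> (nat \<Rightarrow> 'a) \<Rightarrow> (nat \<Rightarrow> 'a) \<Rightarrow>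
   ('a carc \<Rightarrow> real) \<Rightarrow> 'a carc \<Rightarrow> real" where
  "extend_solution D k s t x' e =
     (if e \<in> parcs (reduced_graph D k s t) then x' e
      else if e \<in> arcs1 D k s t then 1
      else if e \<in> arcs0 D k s t then 0
      else undefined)"

end

theory Submission
  imports Defs
begin

text \<open>
  Only the implication from the R-BQP to the BQP needs an argument.  For (2): if an arc of \<open>E\<^sup>1\<close>
  leaves (enters) a copy of \<open>v\<close>, every other arc leaving (entering) a copy of \<open>v\<close> lies in \<open>E\<^sup>0\<close>.
  For (3): if \<open>x\<close> satisfies (1) and (2) but violates (3) at \<open>S\<close>, then every vertex of \<open>S\<close> has
  exactly one selected leaving and one selected entering arc within \<open>S\<close>, i.e. these arcs form
  cycles.  Deleting them preserves (1) and (2); repeating this leads to a BQP-feasible vector that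
  vanishes on the selected arcs within \<open>S\<close>, so none of these is in \<open>E\<^sup>1\<close>.  Hence (3) is already
  violated at \<open>S\<close> by \<open>x'\<close>.
\<close>

section \<open>Binary vectors and their sums\<close>

lemma binary_vectorsD:
  assumes "x \<in> binary_vectors F" "e \<in> F"
  shows "x e = 0 \<or> x e = 1"
  using PiE_mem[OF assms[unfolded binary_vectors_def]] by simp

lemma binary_vectors_nonneg:
  assumes "x \<in> binary_vectors F" "e \<in> F"
  shows "0 \<le> x e"
  using binary_vectorsD[OF assms] by auto

lemma sum_binary_vector:
  assumes "x \<in> binary_vectors F" "finite F" "B \<subseteq> F"
  shows "sum x B = real (card {e \<in> B. x e = 1})"
proof -
  have "sum x B = (\<Sum>e\<in>B. if x e = 1 then 1 else 0)"
    using assms by (intro sum.cong) (auto dest: binary_vectorsD)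
  also have "\<dots> = real (card {e \<in> B. x e = 1})"
    using finite_subset[OF assms(3,2)] by (simp flip: sum.inter_filter)
  finally show ?thesis .
qed

text \<open>The gaps \<open>1 - f w\<close> are nonnegative and their sum is at most 0, so each of
  them vanishes.\<close>

lemma summands_eq_one_if_sum_ge_card:
  fixes f :: "'b \<Rightarrow> real"
  assumes "finite S" "\<And>w. w \<in> S \<Longrightarrow> f w \<le> 1" "real (card S) \<le> sum f S" "w \<in> S"
  shows "f w = 1"
proof -
  have "(\<Sum>w\<in>S. 1 - f w) = 0"
    using assms(1-3) sum_nonneg[of S "\<lambda>w. 1 - f w"] by (auto simp: sum_subtractf)
  with assms show ?thesis
    by (subst (asm) sum_nonneg_eq_0_iff) auto
qed

section \<open>Constraints (2) and (3): one sum per vertex, and monotonicity\<close>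

lemma sum_over_layers:
  fixes k :: nat
  assumes "finite A"
  shows "(\<Sum>i=1..k. \<Sum>e\<in>{e \<in> A. p e = (v, i)}. x e) = sum x {e \<in> A. p e \<in> {v} \<times> {1..k}}"
proof -
  have "{e \<in> A. p e \<in> {v} \<times> {1..k}} = (\<Union>i\<in>{1..k}. {e \<in> A. p e = (v, i)})"
    by auto
  with assms show ?thesis
    by (subst sum.UNION_disjoint[symmetric]) auto
qed

text \<open>Merging the layers gives one packing constraint per vertex and direction. Letting
  \<open>p\<close> be \<open>fst\<close> or \<open>snd\<close> handles leaving and entering arcs by
  the same argument.\<close>

lemma disjointness_constraint_iff:
  assumes "finite (parcs H)"
  shows "disjointness_constraint N k H x \<longleftrightarrow>
    (\<forall>v\<in>N. \<forall>p\<in>{fst, snd}. sum x {e \<in> parcs H. p e \<in> {v} \<times> {1..k}} \<le> 1)"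
  using assms
  by (simp add: disjointness_constraint_def out_arcs_def in_arcs_def sum_over_layers del: One_nat_def)

text \<open>Covers both lowering a vector on a fixed graph (deletion of cycles) and restricting it
  to fewer arcs (the reduced graph). Nonnegativity pays for the arcs that are dropped.\<close>

lemma disjointness_constraint_mono:
  assumes "disjointness_constraint N k H x" "finite (parcs H)" "parcs H' \<subseteq> parcs H"
    "\<And>e. e \<in> parcs H' \<Longrightarrow> x' e \<le> x e" "\<And>e. e \<in> parcs H \<Longrightarrow> 0 \<le> x e"
  shows "disjointness_constraint N k H' x'"
  unfolding disjointness_constraint_iff[OF finite_subset[OF assms(3,2)]]
proof (intro ballI)
  fix v p assume *: "v \<in> N" "p \<in> {fst, snd :: _ \<Rightarrow> 'a cvert}"
  have "sum x' {e \<in> parcs H'. p e \<in> {v} \<times> {1..k}} \<le> sum x {e \<in> parcs H'. p e \<in> {v} \<times> {1..k}}"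
    using assms by (intro sum_mono) auto
  also have "\<dots> \<le> sum x {e \<in> parcs H. p e \<in> {v} \<times> {1..k}}"
    using assms by (intro sum_mono2) auto
  also have "\<dots> \<le> 1"
    using assms(1,2) * by (auto simp: disjointness_constraint_iff)
  finally show "sum x' {e \<in> parcs H'. p e \<in> {v} \<times> {1..k}} \<le> 1" .
qed

lemma subtour_constraint_mono:
  assumes "subtour_constraint N k H x" "finite (parcs H)" "parcs H' \<subseteq> parcs H"
    "\<And>e. e \<in> parcs H' \<Longrightarrow> x' e \<le> x e" "\<And>e. e \<in> parcs H \<Longrightarrow> 0 \<le> x e"
  shows "subtour_constraint N k H' x'"
  unfolding subtour_constraint_def
proof (intro ballI allI impI)
  fix i S assume *: "i \<in> {1..k}" "S \<subseteq> N \<times> {i} \<and> 2 \<le> card S"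
  have "sum x' (arcs_within H' S) \<le> sum x (arcs_within H' S)"
    using assms by (intro sum_mono) (auto simp: arcs_within_def)
  also have "\<dots> \<le> sum x (arcs_within H S)"
    using assms by (intro sum_mono2) (auto simp: arcs_within_def)
  also have "\<dots> \<le> real (card S) - 1"
    using assms(1) * by (auto simp: subtour_constraint_def)
  finally show "sum x' (arcs_within H' S) \<le> real (card S) - 1" .
qed

section \<open>Violated subtour constraints and deletion of cycles\<close>

lemma incident_sum_within_eq_1:
  assumes fin: "finite (parcs H)" and x: "x \<in> binary_vectors (parcs H)"
    and disj: "disjointness_constraint N k H x" and p: "p \<in> {fst, snd}"
    and S: "i \<in> {1..k}" "S \<subseteq> N \<times> {i}" "finite S"
    and viol: "real (card S) - 1 < sum x (arcs_within H S)" and "w \<in> S"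
  shows "sum x {e \<in> arcs_within H S. p e = w} = 1"
proof (rule summands_eq_one_if_sum_ge_card[OF \<open>finite S\<close> _ _ \<open>w \<in> S\<close>])
  fix v assume "v \<in> S"
  then have v: "fst v \<in> N" "snd v = i" using S by auto
  \<comment> \<open>Arcs at \<open>v\<close> within \<open>S\<close> are among the arcs at all
    copies of \<open>fst v\<close>, which (2) bounds by 1.\<close>
  have "sum x {e \<in> arcs_within H S. p e = v} \<le> sum x {e \<in> parcs H. p e \<in> {fst v} \<times> {1..k}}"
    using fin S v by (intro sum_mono2) (auto simp: arcs_within_def mem_Times_iff binary_vectors_nonneg[OF x])
  also have "\<dots> \<le> 1"
    using disj p v unfolding disjointness_constraint_iff[OF fin] by blast
  finally show "sum x {e \<in> arcs_within H S. p e = v} \<le> 1" .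
next
  have sub: "arcs_within H S \<subseteq> parcs H" by (auto simp: arcs_within_def)
  \<comment> \<open>Integrality: the sum counts selected arcs, so exceeding
    \<open>card S - 1\<close> means reaching \<open>card S\<close>.\<close>
  have "real (card S) \<le> sum x (arcs_within H S)"
    using viol sum_binary_vector[OF x fin sub] by simp
  also have "\<dots> = (\<Sum>w\<in>S. sum x {e \<in> arcs_within H S. p e = w})"
    using p S fin finite_subset[OF sub fin]
    by (intro sum.group[symmetric]) (auto simp: arcs_within_def)
  finally show "real (card S) \<le> (\<Sum>w\<in>S. sum x {e \<in> arcs_within H S. p e = w})" .
qed

text \<open>Loops must be excluded: \<open>incidence\<close> tests the tail first and would give a
  loop the value 1, whereas the right-hand side counts it as 0.\<close>

lemma incidence_sum:
  assumes "finite A" "\<And>e. e \<in> A \<Longrightarrow> fst e \<noteq> snd e"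
  shows "(\<Sum>e\<in>A. incidence w e * x e) = sum x {e \<in> A. fst e = w} - sum x {e \<in> A. snd e = w}"
proof -
  have "(\<Sum>e\<in>A. incidence w e * x e)
      = (\<Sum>e\<in>A. (if fst e = w then x e else 0) - (if snd e = w then x e else 0))"
    by (intro sum.cong refl, drule assms(2)) (auto simp add: incidence_def simp del: split_paired_All)
  with assms(1) show ?thesis
    by (simp add: sum_subtractf sum.inter_filter)
qed

text \<open>All arcs within \<open>S\<close> are set to 0 at once. Selected leaving and entering
  arcs within \<open>S\<close> both sum to 1 at each vertex of \<open>S\<close>, so the deleted part
  has net flow 0 everywhere.\<close>

lemma delete_violating_arcs:
  assumes fin: "finite (parcs H)" and loopfree: "\<And>e. e \<in> parcs H \<Longrightarrow> fst e \<noteq> snd e"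
    and x: "x \<in> binary_vectors (parcs H)" and flow: "flow_constraint H d x"
    and disj: "disjointness_constraint N k H x"
    and S: "i \<in> {1..k}" "S \<subseteq> N \<times> {i}" "finite S"
    and viol: "real (card S) - 1 < sum x (arcs_within H S)"
  defines "y \<equiv> \<lambda>e. if e \<in> arcs_within H S then 0 else x e"
  shows "y \<in> binary_vectors (parcs H)" "flow_constraint H d y" "disjointness_constraint N k H y"
proof -
  have sub: "arcs_within H S \<subseteq> parcs H" by (auto simp: arcs_within_def)
  show "y \<in> binary_vectors (parcs H)"
    using x sub unfolding y_def binary_vectors_def by (auto simp: PiE_iff extensional_def)
  show "disjointness_constraint N k H y"
    by (rule disjointness_constraint_mono[OF disj fin]) (auto simp: y_def binary_vectors_nonneg[OF x])
  have bal: "(\<Sum>e\<in>arcs_within H S. incidence w e * x e) = 0" for w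
  proof (cases "w \<in> S")
    case True
    have "(\<Sum>e\<in>arcs_within H S. incidence w e * x e)
        = sum x {e \<in> arcs_within H S. fst e = w} - sum x {e \<in> arcs_within H S. snd e = w}"
      using finite_subset[OF sub fin] sub loopfree by (intro incidence_sum) auto
    with incident_sum_within_eq_1[OF fin x disj _ S viol True] show ?thesis by simp
  next
    case False
    then show ?thesis
      by (intro sum.neutral) (auto simp: arcs_within_def incidence_def)
  qed
  show "flow_constraint H d y"
    unfolding flow_constraint_def
  proof
    fix w assume w: "w \<in> pverts H"
    have "(\<Sum>e\<in>parcs H. incidence w e * y e)
        = (\<Sum>e\<in>parcs H - arcs_within H S. incidence w e * x e)"
      using fin by (intro sum.mono_neutral_cong_right) (auto simp: y_def)
    also have "\<dots> = (\<Sum>e\<in>parcs H. incidence w e * x e)"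
      using sum.subset_diff[OF sub fin, of "\<lambda>e. incidence w e * x e"] bal[of w] by simp
    finally show "(\<Sum>e\<in>parcs H. incidence w e * y e) = d w"
      using flow w by (simp add: flow_constraint_def)
  qed
qed

text \<open>Induction on the number of selected arcs: as long as (3) fails somewhere, a deletion
  lowers it. The bound \<open>y e \<le> x e\<close> records that arcs already at 0 stay at
  0.\<close>

lemma exists_feasible_below:
  assumes fin: "finite (parcs H)" and loopfree: "\<And>e. e \<in> parcs H \<Longrightarrow> fst e \<noteq> snd e"
    and "x \<in> binary_vectors (parcs H)" "flow_constraint H d x" "disjointness_constraint N k H x"
  shows "\<exists>y. feasible_on N k H d y \<and> (\<forall>e\<in>parcs H. y e \<le> x e)"
  using assms(3-)
proof (induction "card {e \<in> parcs H. x e = 1}" arbitrary: x rule: less_induct)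
  case less
  note x = less.prems(1)
  show ?case
  proof (cases "subtour_constraint N k H x")
    case True
    with less.prems show ?thesis by (auto simp: feasible_on_def)
  next
    case False
    then obtain i S where S: "i \<in> {1..k}" "S \<subseteq> N \<times> {i}" "2 \<le> card S"
      and viol: "real (card S) - 1 < sum x (arcs_within H S)"
      by (auto simp: subtour_constraint_def not_le)
    have "finite S" using S(3) by (simp add: card_ge_0_finite)
    define y where "y = (\<lambda>e. if e \<in> arcs_within H S then 0 else x e)"
    note y = delete_violating_arcs[OF fin loopfree less.prems S(1,2) \<open>finite S\<close> viol, folded y_def]
    have y_le: "y e \<le> x e" if "e \<in> parcs H" for e
      using binary_vectors_nonneg[OF x that] by (simp add: y_def)
    \<comment> \<open>Since \<open>card S\<close> is at least 2, the violated bound is positive.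
      Hence some selected arc is deleted, and the induction measure drops strictly.\<close>
    have "sum x (arcs_within H S) \<noteq> 0"
      using viol S(3) by simp
    then obtain e where "e \<in> arcs_within H S" "x e \<noteq> 0"
      by (meson sum.neutral)
    then have e: "e \<in> parcs H" "x e = 1" "y e = 0"
      using binary_vectorsD[OF x, of e] by (auto simp: arcs_within_def y_def)
    have "{e \<in> parcs H. y e = 1} \<subset> {e \<in> parcs H. x e = 1}"
    proof (rule psubsetI)
      show "{e \<in> parcs H. y e = 1} \<subseteq> {e \<in> parcs H. x e = 1}" by (auto simp: y_def split: if_splits)
      show "{e \<in> parcs H. y e = 1} \<noteq> {e \<in> parcs H. x e = 1}" using e by force
    qed
    then have "card {e \<in> parcs H. y e = 1} < card {e \<in> parcs H. x e = 1}"
      using fin by (intro psubset_card_mono) auto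
    from less.hyps[OF this y] y_le show ?thesis by (meson order_trans)
  qed
qed

section \<open>The copies and the extended vector\<close>

lemma
  assumes "pair_digraph D"
  shows finite_parcs_copies: "finite (parcs (copies k D))"
    and loopfree_copies: "e \<in> parcs (copies k D) \<Longrightarrow> fst e \<noteq> snd e"
proof -
  interpret pair_digraph D by fact
  have "parcs (copies k D) \<subseteq> (\<lambda>(e, i). ((fst e, i), (snd e, i))) ` (parcs D \<times> {1..k})"
    by (force simp: copies_def image_iff)
  then show "finite (parcs (copies k D))" by (rule finite_subset) simp
  show "e \<in> parcs (copies k D) \<Longrightarrow> fst e \<noteq> snd e"
    using no_loops by (auto simp: copies_def)
qed

text \<open>The definition tests \<open>arcs1\<close> before \<open>arcs0\<close>; the value 0 on
  \<open>arcs0\<close> therefore relies on the disjointness of the two sets, which comes from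
  feasibility of the BQP.\<close>

lemma extend_solution_simps:
  shows "e \<in> parcs (reduced_graph D k s t) \<Longrightarrow> extend_solution D k s t x' e = x' e"
    and "e \<in> arcs1 D k s t \<Longrightarrow> extend_solution D k s t x' e = 1"
    and "e \<in> arcs0 D k s t \<Longrightarrow> \<exists>x. bqp_feasible D k s t x \<Longrightarrow> extend_solution D k s t x' e = 0"
  using fixed_arcs_disjoint[of D k s t] by (auto simp: extend_solution_def reduced_graph_def)

lemma extend_solution_binary:
  assumes "x' \<in> binary_vectors (parcs (reduced_graph D k s t))"
  shows "extend_solution D k s t x' \<in> binary_vectors (parcs (copies k D))"
  unfolding binary_vectors_def
proof (rule PiE_I)
  fix e assume "e \<in> parcs (copies k D)"
  then show "extend_solution D k s t x' e \<in> {0, 1}"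
    using binary_vectorsD[OF assms] by (auto simp: extend_solution_def reduced_graph_def)
next
  \<comment> \<open>Outside the arcs all three tests fail, leaving the default that extensionality
    demands.\<close>
  fix e assume "e \<notin> parcs (copies k D)"
  then show "extend_solution D k s t x' e = undefined"
    by (auto simp: extend_solution_def reduced_graph_def arcs0_def arcs1_def)
qed

text \<open>The arcs of E^0 drop out and those of E^1 contribute their weight. The weight
  \<open>g\<close> will be a row of \<open>Q\<close> for the objective, \<open>incidence w\<close>
  for (1), and the constant 1 for (2) and (3).\<close>

lemma sum_extend_solution:
  fixes g :: "'a carc \<Rightarrow> real"
  assumes fin: "finite (parcs (copies k D))" and feas: "\<exists>x. bqp_feasible D k s t x"
    and B: "B \<subseteq> parcs (copies k D)"
  shows "(\<Sum>e\<in>B. g e * extend_solution D k s t x' e)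
    = (\<Sum>e\<in>B \<inter> parcs (reduced_graph D k s t). g e * x' e) + sum g (B \<inter> arcs1 D k s t)"
proof -
  let ?E = "parcs (reduced_graph D k s t)" and ?E1 = "arcs1 D k s t"
  have finB: "finite B" using fin B by (rule rev_finite_subset)
  have "(\<Sum>e\<in>B. g e * extend_solution D k s t x' e)
      = (\<Sum>e\<in>B \<inter> ?E \<union> B \<inter> ?E1. g e * extend_solution D k s t x' e)"
    using B by (intro sum.mono_neutral_right finB)
      (auto simp: reduced_graph_def intro!: extend_solution_simps(3)[OF _ feas])
  also have "\<dots> = (\<Sum>e\<in>B \<inter> ?E. g e * extend_solution D k s t x' e)
      + (\<Sum>e\<in>B \<inter> ?E1. g e * extend_solution D k s t x' e)"
    using finB by (intro sum.union_disjoint) (auto simp: reduced_graph_def)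
  also have "\<dots> = (\<Sum>e\<in>B \<inter> ?E. g e * x' e) + sum g (B \<inter> ?E1)"
    by (intro arg_cong2[where f = "(+)"] sum.cong) (auto simp: extend_solution_simps)
  finally show ?thesis .
qed

section \<open>Equality of the objective values\<close>

lemma objective_extend_solution:
  assumes fin: "finite (parcs (copies k D))" and feas: "\<exists>x. bqp_feasible D k s t x"
  shows "bqp_objective D k Q (extend_solution D k s t x') = rbqp_objective D k s t Q x'"
proof -
  let ?F = "parcs (copies k D)" and ?E = "parcs (reduced_graph D k s t)" and ?E1 = "arcs1 D k s t"
  let ?x = "extend_solution D k s t x'"
  have sub: "?F \<inter> ?E = ?E" "?F \<inter> ?E1 = ?E1"
    by (auto simp: reduced_graph_def arcs1_def)
  note split = sum_extend_solution[OF fin feas order_refl, unfolded sub]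
  \<comment> \<open>\<open>r e\<close> is row \<open>e\<close> of \<open>Q\<close> applied to the
    extended vector, already split into E and E^1. Using it as the weight of a second split yields
    the four blocks of the quadratic form.\<close>
  define r where "r e = (\<Sum>f\<in>?E. Q e f * x' f) + sum (Q e) ?E1" for e
  have "bqp_objective D k Q ?x = (\<Sum>e\<in>?F. (\<Sum>f\<in>?F. Q e f * ?x f) * ?x e)"
    unfolding bqp_objective_def quad_form_def sum_distrib_right by (simp add: mult_ac)
  also have "\<dots> = (\<Sum>e\<in>?F. r e * ?x e)"
    unfolding split r_def ..
  also have "\<dots> = (\<Sum>e\<in>?E. r e * x' e) + sum r ?E1"
    by (rule split)
  also have "\<dots> = quad_form ?E Q x' + ((\<Sum>e\<in>?E. sum (Q e) ?E1 * x' e)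
      + (\<Sum>e\<in>?E1. \<Sum>f\<in>?E. Q e f * x' f)) + reduced_constant D k s t Q"
    by (simp add: r_def quad_form_def reduced_constant_def sum.distrib sum_distrib_right
        distrib_left sum_distrib_left mult_ac)
  \<comment> \<open>Swapping the sums lets the E^1-by-E block run over E on the outside, so that it
    joins the E-by-E^1 block in \<open>reduced_linear\<close>.\<close>
  also have "(\<Sum>e\<in>?E1. \<Sum>f\<in>?E. Q e f * x' f) = (\<Sum>f\<in>?E. (\<Sum>e\<in>?E1. Q e f) * x' f)"
    by (subst sum.swap) (simp add: sum_distrib_right)
  also have "(\<Sum>e\<in>?E. sum (Q e) ?E1 * x' e) + \<dots> = (\<Sum>e\<in>?E. reduced_linear D k s t Q e * x' e)"
    by (simp add: reduced_linear_def sum.distrib distrib_right)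
  finally show ?thesis by (simp add: rbqp_objective_def)
qed

section \<open>Transfer of the constraints to the extended vector\<close>

lemma flow_constraint_extend_solution:
  assumes fin: "finite (parcs (copies k D))" and feas: "\<exists>x. bqp_feasible D k s t x"
  shows "flow_constraint (copies k D) (demand s t) (extend_solution D k s t x') \<longleftrightarrow>
    flow_constraint (reduced_graph D k s t) (reduced_demand D k s t) x'"
proof -
  have "parcs (copies k D) \<inter> parcs (reduced_graph D k s t) = parcs (reduced_graph D k s t)"
    "parcs (copies k D) \<inter> arcs1 D k s t = arcs1 D k s t"
    "pverts (reduced_graph D k s t) = pverts (copies k D)"
    by (auto simp: reduced_graph_def arcs1_def)
  \<comment> \<open>For the weight \<open>incidence w\<close>, the E^1 part is exactly the amount
    subtracted in \<open>reduced_demand\<close>.\<close>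
  with sum_extend_solution[OF fin feas order_refl, of "incidence _" x'] show ?thesis
    by (auto simp: flow_constraint_def reduced_demand_def algebra_simps)
qed

text \<open>If \<open>U\<close> contains an arc of E^1, it uses up the bound 1 in every feasible
  \<open>z\<close>, so the rest of \<open>U\<close> lies in E^0 and the extended sum is 1. Otherwise
  the extension adds nothing to the sum of \<open>x'\<close>.\<close>

lemma packing_constraint_extend_solution:
  assumes fin: "finite (parcs (copies k D))" and feas: "\<exists>x. bqp_feasible D k s t x"
    and U: "U \<subseteq> parcs (copies k D)"
    and valid: "\<And>z. bqp_feasible D k s t z \<Longrightarrow> sum z U \<le> 1"
    and le: "sum x' (U \<inter> parcs (reduced_graph D k s t)) \<le> 1"
  shows "sum (extend_solution D k s t x') U \<le> 1"
proof -
  let ?E = "parcs (reduced_graph D k s t)" and ?E1 = "arcs1 D k s t"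
  have split: "sum (extend_solution D k s t x') U = sum x' (U \<inter> ?E) + card (U \<inter> ?E1)"
    using sum_extend_solution[OF fin feas U, of "\<lambda>_. 1" x'] by simp
  show ?thesis
  proof (cases "U \<inter> ?E1 = {}")
    case True
    with split le show ?thesis by simp
  next
    case False
    then obtain e where e: "e \<in> U" "e \<in> ?E1" by auto
    have others: "f \<in> arcs0 D k s t" if f: "f \<in> U" "f \<noteq> e" for f
    proof -
      have "z f = 0" if z: "bqp_feasible D k s t z" for z
      proof -
        have bin: "z \<in> binary_vectors (parcs (copies k D))"
          using z by (simp add: bqp_feasible_def feasible_on_def)
        have "z e + z f = sum z {e, f}" using f by simp
        also have "\<dots> \<le> sum z U"
          using e f U fin by (intro sum_mono2) (auto intro: binary_vectors_nonneg[OF bin] finite_subset)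
        also have "\<dots> \<le> 1" by (rule valid[OF z])
        finally have "z f \<le> 0" using e(2) z by (auto simp: arcs1_def)
        with binary_vectorsD[OF bin, of f] f U show ?thesis by auto
      qed
      with f U show ?thesis by (auto simp: arcs0_def)
    qed
    have "U \<inter> ?E = {}" "U \<inter> ?E1 = {e}"
      using others e fixed_arcs_disjoint[OF feas] unfolding reduced_graph_def by fastforce+
    with split show ?thesis by simp
  qed
qed

lemma disjointness_constraint_extend_solution:
  assumes fin: "finite (parcs (copies k D))" and feas: "\<exists>x. bqp_feasible D k s t x"
    and disj: "disjointness_constraint (pverts D) k (reduced_graph D k s t) x'"
  shows "disjointness_constraint (pverts D) k (copies k D) (extend_solution D k s t x')"
  unfolding disjointness_constraint_iff[OF fin]
proof (intro ballI)
  fix v p assume *: "v \<in> pverts D" "p \<in> {fst, snd :: _ \<Rightarrow> 'a cvert}"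
  let ?U = "{e \<in> parcs (copies k D). p e \<in> {v} \<times> {1..k}}"
  have sub: "parcs (reduced_graph D k s t) \<subseteq> parcs (copies k D)"
    by (auto simp: reduced_graph_def)
  show "sum (extend_solution D k s t x') ?U \<le> 1"
  proof (rule packing_constraint_extend_solution[OF fin feas])
    show "sum z ?U \<le> 1" if "bqp_feasible D k s t z" for z
      using that * unfolding bqp_feasible_def feasible_on_def disjointness_constraint_iff[OF fin]
      by blast
    have "sum x' {e \<in> parcs (reduced_graph D k s t). p e \<in> {v} \<times> {1..k}} \<le> 1"
      using disj * unfolding disjointness_constraint_iff[OF finite_subset[OF sub fin]] by blast
    moreover have "?U \<inter> parcs (reduced_graph D k s t)
        = {e \<in> parcs (reduced_graph D k s t). p e \<in> {v} \<times> {1..k}}"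
      using sub by auto
    ultimately show "sum x' (?U \<inter> parcs (reduced_graph D k s t)) \<le> 1"
      by simp
  qed auto
qed

lemma subtour_constraint_extend_solution:
  assumes "pair_digraph D" and feas: "\<exists>x. bqp_feasible D k s t x"
    and x': "x' \<in> binary_vectors (parcs (reduced_graph D k s t))"
    and flow: "flow_constraint (copies k D) (demand s t) (extend_solution D k s t x')"
    and disj: "disjointness_constraint (pverts D) k (copies k D) (extend_solution D k s t x')"
    and sub': "subtour_constraint (pverts D) k (reduced_graph D k s t) x'"
  shows "subtour_constraint (pverts D) k (copies k D) (extend_solution D k s t x')"
proof (rule ccontr)
  let ?H = "copies k D" and ?x = "extend_solution D k s t x'"
  note fin = finite_parcs_copies[OF assms(1), of k] and loopfree = loopfree_copies[OF assms(1), of _ k]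
  note x = extend_solution_binary[OF x']
  assume "\<not> subtour_constraint (pverts D) k ?H ?x"
  then obtain i S where S: "i \<in> {1..k}" "S \<subseteq> pverts D \<times> {i}" "2 \<le> card S"
    and viol: "real (card S) - 1 < sum ?x (arcs_within ?H S)"
    by (auto simp: subtour_constraint_def not_le)
  have "finite S" using S(3) by (simp add: card_ge_0_finite)
  \<comment> \<open>One deletion at \<open>S\<close> is made by hand before descending further,
    which forces \<open>y\<close> to vanish on all arcs within \<open>S\<close>.\<close>
  from exists_feasible_below[OF fin loopfree
      delete_violating_arcs[OF fin loopfree x flow disj S(1,2) \<open>finite S\<close> viol]]
  obtain y where y: "bqp_feasible D k s t y"
    and y_le: "\<forall>e\<in>parcs ?H. y e \<le> (if e \<in> arcs_within ?H S then 0 else ?x e)"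
    unfolding bqp_feasible_def by blast
  \<comment> \<open>An arc of E^1 within \<open>S\<close> would need \<open>y e = 1\<close>, against
    \<open>y e \<le> 0\<close>.\<close>
  have no1: "arcs_within ?H S \<inter> arcs1 D k s t = {}"
    using y y_le by (force simp: arcs1_def)
  have "sum ?x (arcs_within ?H S) = sum x' (arcs_within ?H S \<inter> parcs (reduced_graph D k s t))"
    using sum_extend_solution[OF fin feas, of "arcs_within ?H S" "\<lambda>_. 1" x'] no1
    by (simp add: arcs_within_def)
  also have "arcs_within ?H S \<inter> parcs (reduced_graph D k s t)
      = arcs_within (reduced_graph D k s t) S"
    by (auto simp: arcs_within_def reduced_graph_def)
  also have "sum x' \<dots> \<le> real (card S) - 1"
    using sub' S by (auto simp: subtour_constraint_def)
  finally show False using viol by simp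
qed

theorem theorem4p7:
  fixes D :: "'a pair_pre_digraph"
    and k :: nat
    and s t :: "nat \<Rightarrow> 'a"
    and Q :: "'a carc \<Rightarrow> 'a carc \<Rightarrow> real"
    and x' :: "'a carc \<Rightarrow> real"
  assumes "pair_digraph D"
    and "terminal_pairs (pverts D) k s t"
    and "\<forall>e\<in>parcs (copies k D). \<forall>f\<in>parcs (copies k D). Q e f = Q f e"
    and "\<exists>x. bqp_feasible D k s t x"
    and "x' \<in> binary_vectors (parcs (reduced_graph D k s t))"
  shows "(rbqp_feasible D k s t x' \<longleftrightarrow> bqp_feasible D k s t (extend_solution D k s t x'))
    \<and> bqp_objective D k Q (extend_solution D k s t x') = rbqp_objective D k s t Q x'"
proof (intro conjI iffI)
  let ?x = "extend_solution D k s t x'"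
  note feas = assms(4) and x' = assms(5)
  note fin = finite_parcs_copies[OF assms(1), of k]
  note x = extend_solution_binary[OF x']
  show "bqp_objective D k Q ?x = rbqp_objective D k s t Q x'"
    by (rule objective_extend_solution[OF fin feas])
  \<comment> \<open>The order matters: (3) for \<open>?x\<close> is derived from (1) and (2) for
    \<open>?x\<close>, which are transferred first.\<close>
  show "bqp_feasible D k s t ?x" if "rbqp_feasible D k s t x'"
    using that x flow_constraint_extend_solution[OF fin feas]
      disjointness_constraint_extend_solution[OF fin feas]
      subtour_constraint_extend_solution[OF assms(1) feas x']
    by (simp add: rbqp_feasible_def bqp_feasible_def feasible_on_def)
  have sub: "parcs (reduced_graph D k s t) \<subseteq> parcs (copies k D)"
    by (auto simp: reduced_graph_def)
  have le: "x' e \<le> ?x e" if "e \<in> parcs (reduced_graph D k s t)" for e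
    using that by (simp add: extend_solution_simps)
  \<comment> \<open>For (2) and (3) the bounds are the same on both graphs, and removing arcs only
    drops nonnegative summands.\<close>
  show "rbqp_feasible D k s t x'" if "bqp_feasible D k s t ?x"
    using that x' flow_constraint_extend_solution[OF fin feas]
      disjointness_constraint_mono[OF _ fin sub le binary_vectors_nonneg[OF x]]
      subtour_constraint_mono[OF _ fin sub le binary_vectors_nonneg[OF x]]
    by (simp add: rbqp_feasible_def bqp_feasible_def feasible_on_def)
qed

end
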